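(* For each integer $m\ge 0$ and each real $x\in[0,1/2]$, the functions $t\mapsto G_m(x,t)$ and $t\mapsto H_m(x,t)$ are completely monotonic on $t\in(0,\infty)$, where $$G_m(x,t):=(-1)^{m-1}\left(\log\left(\frac{\Gamma(t+1-x)\Gamma(t+x)}{\Gamma(t)\Gamma(t+1)}\right)-\sum_{\ell=1}^m\frac{B_{2\ell}(x)-B_{2\ell}}{\ell(2\ell-1)}\frac{1}{t^{2\ell-1}}\right)$$ and $$H_m(x,t):=(-1)^m\left(\log\left(\frac{\Gamma(t+1-x)}{t^{1-2x}\Gamma(t+x)}\right)-\sum_{\ell=1}^m\frac{B_{2\ell+1}(x)}{\ell(2\ell+1)}\frac{1}{t^{2\ell}}\right).$$
   Context: $\Gamma$ is Euler's gamma function. For each integer $n\ge 0$ and real $x$, the $n$th Bernoulli polynomial $B_n(x)$ is defined by $\sum_{n\ge 0}\frac{B_n(x)}{n!}s^n=\frac{se^{sx}}{e^s-1}$ for $|s|<2\pi$, and $B_n:=B_n(0)$ is the $n$th Bernoulli number. Empty sums are equal to $0$. An infinitely differentiable function $f$ on an open interval $I\subset\mathbb{R}$ is called completely monotonic over $I$ if $(-1)^n f^{(n)}(t)\ge 0$ for all $t\in I$ and all integers $n\ge 0$. *)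

theory Defs
  imports "HOL-Complex_Analysis.Complex_Analysis"
begin

text \<open>
  The sequence \<open>n \<mapsto> B\<^sub>n(x)\<close> is the unique one satisfying the generating function identity; see
  \<open>bernpoly_sums\<close> and \<open>bernpoly_unique\<close> below. The removable singularity \<open>s = 0\<close> is
  left out because \<open>s * exp (s * x) / (exp s - 1)\<close> evaluates to \<open>0\<close> there.
\<close>
definition bernpoly_gf :: "real \<Rightarrow> (nat \<Rightarrow> real) \<Rightarrow> bool" where
  "bernpoly_gf x b \<longleftrightarrow>
     (\<forall>s::complex. s \<noteq> 0 \<and> norm s < 2 * pi \<longrightarrow>
        (\<lambda>n. complex_of_real (b n) / fact n * s ^ n) sums
          (s * exp (s * complex_of_real x) / (exp s - 1)))"

definition bernpoly :: "nat \<Rightarrow> real \<Rightarrow> real" where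
  "bernpoly n x = (THE b. bernpoly_gf x b) n"

definition bernoulli :: "nat \<Rightarrow> real" where
  "bernoulli n = bernpoly n 0"

lemma bernpoly_gf_fps:
  "bernpoly_gf x (\<lambda>n. fact n * fps_nth (fps_exp x * inverse (fps_shift 1 (fps_exp 1 - 1))) n)"
proof -
  define D :: "complex fps" where "D = fps_shift 1 (fps_exp 1 - 1)"
  define Dr :: "real fps" where "Dr = fps_shift 1 (fps_exp 1 - 1)"
  define Q :: "complex fps" where "Q = fps_exp (of_real x) * inverse D"
  define Qr :: "real fps" where "Qr = fps_exp x * inverse Dr"
  have D0: "fps_nth D 0 = 1" and Dr0: "fps_nth Dr 0 = 1"
    by (simp_all add: D_def Dr_def)
  have real: "fps_nth Q n = of_real (fps_nth Qr n)" for n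
  proof -
    have "Qr * Dr = fps_exp x"
      using Dr0 by (simp add: Qr_def mult.assoc inverse_mult_eq_1)
    hence "(\<Sum>i=0..k. fps_nth Qr i * fps_nth Dr (k - i)) = x ^ k / fact k" for k
      unfolding fps_mult_nth[symmetric] by simp
    hence *: "(\<Sum>i=0..k. complex_of_real (fps_nth Qr i) * of_real (fps_nth Dr (k - i))) =
        of_real (x ^ k / fact k)" for k
      unfolding of_real_mult[symmetric] of_real_sum[symmetric] by (rule arg_cong)
    have "of_real (fps_nth Dr k) = fps_nth D k" for k
      by (simp add: D_def Dr_def)
    with * have "Abs_fps (\<lambda>n. of_real (fps_nth Qr n)) * D = fps_exp (of_real x)"
      by (intro fps_ext) (simp add: fps_mult_nth)
    hence "Abs_fps (\<lambda>n. of_real (fps_nth Qr n)) * (D * inverse D) = Q"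
      by (simp add: Q_def mult.assoc[symmetric])
    hence "Abs_fps (\<lambda>n. of_real (fps_nth Qr n)) = Q"
      using D0 by (simp add: inverse_mult_eq_1')
    thus ?thesis by (simp add: fps_eq_iff)
  qed
  have sub: "1 \<le> subdegree (fps_exp 1 - 1 :: complex fps)"
  proof (rule subdegree_geI)
    have "fps_nth (fps_exp 1 - 1 :: complex fps) 1 \<noteq> 0" by simp
    thus "fps_exp 1 - 1 \<noteq> (0 :: complex fps)" by (metis fps_zero_nth)
  qed auto
  have "fps_conv_radius (fps_exp 1 - 1 :: complex fps) \<ge> min \<infinity> \<infinity>"
    by (rule order_trans[OF _ fps_conv_radius_diff]) simp
  hence rad: "fps_conv_radius (fps_exp 1 - 1 :: complex fps) = \<infinity>" by simp
  hence radD: "fps_conv_radius D = \<infinity>" by (simp add: D_def)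
  have evalD: "eval_fps D z = (if z = 0 then 1 else (exp z - 1) / z)" for z
    using sub rad by (simp add: D_def eval_fps_shift eval_fps_diff)
  have nz: "eval_fps D z \<noteq> 0" if "z \<in> eball 0 (ereal (2 * pi))" for z
  proof (cases "z = 0")
    case False
    have "norm z < 2 * pi" using that by simp
    have "exp z \<noteq> 1"
    proof
      assume "exp z = 1"
      then obtain n :: int where n: "Re z = 0" "Im z = of_int (2 * n) * pi"
        unfolding exp_eq_1 by blast
      with False have "n \<noteq> 0" by (auto simp: complex_eq_iff)
      hence "2 * pi \<le> \<bar>of_int (2 * n)\<bar> * pi" by (intro mult_right_mono) auto
      also have "\<dots> = \<bar>Im z\<bar>" using n by (simp add: abs_mult)
      also have "\<dots> \<le> norm z" by (rule abs_Im_le_cmod)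
      finally show False using \<open>norm z < 2 * pi\<close> by simp
    qed
    thus ?thesis using False by (simp add: evalD)
  qed (simp add: evalD)
  have radI: "fps_conv_radius (inverse D) \<ge> min (ereal (2 * pi)) (fps_conv_radius D)"
    by (rule fps_conv_radius_inverse) (use nz radD in auto)
  have "(\<lambda>n. fps_nth Q n * s ^ n) sums (s * exp (s * of_real x) / (exp s - 1))"
    if s: "s \<noteq> 0" "norm s < 2 * pi" for s
  proof -
    have s': "ereal (norm s) < fps_conv_radius (inverse D)"
    proof (rule less_le_trans)
      show "ereal (norm s) < ereal (2 * pi)" using s by simp
      show "ereal (2 * pi) \<le> fps_conv_radius (inverse D)" using radI radD by simp
    qed
    have "eval_fps (inverse D) s = inverse (eval_fps D s)"
      by (rule eval_fps_inverse[where r = "ereal (2 * pi)"]) (use nz radD s in auto)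
    hence "eval_fps Q s = s * exp (s * of_real x) / (exp s - 1)"
      using s s' by (simp add: Q_def eval_fps_mult evalD field_simps)
    moreover have "ereal (norm s) < fps_conv_radius Q"
      using s' fps_conv_radius_mult[of "fps_exp (of_real x)" "inverse D"]
      by (auto simp: Q_def intro: less_le_trans)
    ultimately show ?thesis using sums_eval_fps[of s Q] by simp
  qed
  thus ?thesis
    unfolding bernpoly_gf_def by (simp add: real Qr_def Dr_def)
qed

lemma bernpoly_unique:
  assumes "bernpoly_gf x b" "bernpoly_gf x c"
  shows "b = c"
proof -
  define a where "a n = complex_of_real (b n - c n) / fact n" for n
  have a0: "(\<lambda>n. a n * s ^ n) sums 0" if "s \<noteq> 0" "norm s < 2 * pi" for s
  proof -
    have "(\<lambda>n. of_real (b n) / fact n * s ^ n - of_real (c n) / fact n * s ^ n) sums 0"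
      using sums_diff[OF assms(1)[unfolded bernpoly_gf_def, rule_format, OF conjI[OF that]]
          assms(2)[unfolded bernpoly_gf_def, rule_format, OF conjI[OF that]]] by simp
    thus ?thesis by (simp add: a_def diff_divide_distrib left_diff_distrib)
  qed
  have "a n = 0" for n
  proof (induction n rule: less_induct)
    case (less n)
    have "(\<lambda>k. a (k + n) * s ^ k) sums 0" if "s \<noteq> 0" "norm s < 2 * pi" for s
    proof -
      have "(\<lambda>k. a (k + n) * s ^ (k + n)) sums (0 - (\<Sum>k<n. a k * s ^ k))"
        by (subst sums_iff_shift) (use a0[OF that] in simp)
      also have "(\<Sum>k<n. a k * s ^ k) = 0" using less by simp
      finally have "(\<lambda>k. inverse (s ^ n) * (a (k + n) * s ^ (k + n))) sums (inverse (s ^ n) * (0 - 0))"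
        by (rule sums_mult)
      moreover have "inverse (s ^ n) * (a (k + n) * s ^ (k + n)) = a (k + n) * s ^ k" for k
        using that(1) by (simp add: power_add)
      ultimately show ?thesis by simp
    qed
    hence "((\<lambda>_. 0) \<longlongrightarrow> a (0 + n)) (at (0::complex))"
      by (intro powser_limit_0_strong[where s = "2 * pi"]) auto
    thus ?case by (simp add: tendsto_const_iff)
  qed
  thus ?thesis by (auto simp: a_def)
qed

lemma bernpoly_eqI:
  assumes "bernpoly_gf x b"
  shows "bernpoly n x = b n"
  unfolding bernpoly_def by (subst the_equality[of "bernpoly_gf x" b]) (use assms bernpoly_unique in auto)

lemma bernpoly_conv_fps:
  "bernpoly n x = fact n * fps_nth (fps_exp x * inverse (fps_shift 1 (fps_exp 1 - 1))) n"
  by (rule bernpoly_eqI[OF bernpoly_gf_fps])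

lemma bernpoly_sums:
  assumes "s \<noteq> 0" "norm (s :: complex) < 2 * pi"
  shows "(\<lambda>n. complex_of_real (bernpoly n x) / fact n * s ^ n) sums
           (s * exp (s * complex_of_real x) / (exp s - 1))"
  using bernpoly_gf_fps[of x] assms unfolding bernpoly_conv_fps bernpoly_gf_def by blast

text \<open>
  Meant for an open interval \<open>I\<close>: there the iterated derivatives \<open>(deriv ^^ n) f\<close> depend only
  on the values of \<open>f\<close> on \<open>I\<close>.
\<close>
definition completely_monotonic_on :: "real set \<Rightarrow> (real \<Rightarrow> real) \<Rightarrow> bool" where
  "completely_monotonic_on I f \<longleftrightarrow>
     (\<forall>n. \<forall>t\<in>I. (deriv ^^ n) f differentiable (at t)) \<and>
     (\<forall>n. \<forall>t\<in>I. (-1) ^ n * (deriv ^^ n) f t \<ge> 0)"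

text \<open>The sign \<open>(-1)\<^sup>m\<^sup>-\<^sup>1\<close> is an integer power, so that it is \<open>-1\<close> for \<open>m = 0\<close>.\<close>
definition G :: "nat \<Rightarrow> real \<Rightarrow> real \<Rightarrow> real" where
  "G m x t = (-1) powi (int m - 1) *
     (ln (Gamma (t + 1 - x) * Gamma (t + x) / (Gamma t * Gamma (t + 1)))
      - (\<Sum>l=1..m. (bernpoly (2 * l) x - bernoulli (2 * l)) / (real l * (2 * real l - 1))
                     * (1 / t ^ (2 * l - 1))))"

definition H :: "nat \<Rightarrow> real \<Rightarrow> real \<Rightarrow> real" where
  "H m x t = (-1) ^ m *
     (ln (Gamma (t + 1 - x) / (t powr (1 - 2 * x) * Gamma (t + x)))
      - (\<Sum>l=1..m. bernpoly (2 * l + 1) x / (real l * (2 * real l + 1)) * (1 / t ^ (2 * l))))"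

end

theory Submission
  imports Defs
begin

text \<open>
  For \<open>t > 0\<close> let \<open>L(x,t) = log \<Gamma>(t+1-x) - log \<Gamma>(t+x)\<close> and let
  \<open>h\<^sub>k(x,t) = L(x,t) + 2 \<Sum>\<^sub>l\<^sub><\<^sub>k B\<^sub>2\<^sub>l\<^sub>+\<^sub>1(x)/(2l+1)! (log t)\<^bsup>(2l)\<^esup>\<close>, where a
  parenthesized exponent is an order of differentiation. The derivative of order \<open>2l > 0\<close>
  of \<open>log t\<close> is a multiple of \<open>t\<^bsup>-2l\<^esup>\<close>, and the term \<open>l = 0\<close> produces the power \<open>t\<^bsup>1-2x\<^esup>\<close>,
  so that \<open>H m = (-1)\<^sup>m h\<^sub>m\<^sub>+\<^sub>1\<close>.

  These functions are linked by differentiation in the parameter \<open>x\<close>.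
  Since \<open>(B\<^sub>n/n!)' = B\<^sub>n\<^sub>-\<^sub>1/(n-1)!\<close>, they satisfy the wave-type recursion
  \<open>\<partial>\<^sub>x\<^sup>2 h\<^sub>k\<^sub>+\<^sub>1 = \<partial>\<^sub>t\<^sup>2 h\<^sub>k\<close>. Moreover \<open>h\<^sub>k\<^sub>+\<^sub>1\<close> vanishes at \<open>x = 0\<close> (by
  \<open>\<Gamma>(t+1) = t \<Gamma>(t)\<close> and the vanishing of odd Bernoulli numbers beyond the first) and at
  \<open>x = 1/2\<close> (by the symmetry \<open>x \<mapsto> 1-x\<close>). A function on \<open>[0,1/2]\<close> with zero boundary values
  is nonnegative if it is concave and nonpositive if it is convex. Applied to each
  \<open>t\<close>-derivative, this gives the sign of \<open>\<partial>\<^sub>t\<^sup>n h\<^sub>k\<close> by induction on \<open>k\<close>, starting from the monotonicity of the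
  polygamma functions; this is \<open>h_rem_sign\<close>.

  The function \<open>g\<^sub>m\<close> belonging to \<open>G m = (-1)\<^bsup>m-1\<^esup> g\<^sub>m\<close> vanishes at \<open>x = 0\<close> and satisfies
  \<open>\<partial>\<^sub>x g\<^sub>m = -\<partial>\<^sub>t h\<^sub>m\<close>, so the signs of its \<open>t\<close>-derivatives follow by monotonicity in \<open>x\<close>;
  this is \<open>g_rem_sign\<close>.
\<close>

section \<open>Bernoulli polynomials\<close>

text \<open>Dividing by \<open>n!\<close> turns \<open>B\<^sub>n' = n B\<^sub>n\<^sub>-\<^sub>1\<close> into a recursion without factors.\<close>
definition bernpoly_div_fact :: "nat \<Rightarrow> real \<Rightarrow> real" where
  "bernpoly_div_fact n x = bernpoly n x / fact n"

lemma bernpoly_div_fact_has_derivative: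
  "(bernpoly_div_fact (Suc n) has_real_derivative bernpoly_div_fact n x) (at x)"
proof -
  define c :: "nat \<Rightarrow> real" where "c = fps_nth (inverse (fps_shift 1 (fps_exp 1 - 1)))"
  have b: "bernpoly_div_fact k y = (\<Sum>i=0..k. y ^ i / fact i * c (k - i))" for k y
    by (simp add: bernpoly_div_fact_def bernpoly_conv_fps fps_mult_nth c_def)
  have split: "bernpoly_div_fact (Suc n) =
      (\<lambda>y. c (Suc n) + (\<Sum>i=0..n. y ^ Suc i / fact (Suc i) * c (n - i)))"
    unfolding b fun_eq_iff by (subst sum.atLeast0_atMost_Suc_shift) simp
  have pow: "((\<lambda>y. y ^ Suc i / fact (Suc i)) has_real_derivative x ^ i / fact i) (at x)" for i
    by (rule derivative_eq_intros refl | simp add: field_simps del: of_nat_Suc)+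
  show ?thesis
    unfolding split unfolding b
    by (rule DERIV_cong[OF DERIV_add[OF DERIV_const DERIV_sum[OF DERIV_cmult_right[OF pow]]]]) simp
qed

text \<open>The substitution \<open>s \<mapsto> -s\<close> in the generating function.\<close>
lemma bernpoly_reflect: "bernpoly n (1 - x) = (-1) ^ n * bernpoly n x"
proof -
  have "bernpoly_gf (1 - x) (\<lambda>n. (-1) ^ n * bernpoly n x)"
    unfolding bernpoly_gf_def
  proof (intro allI impI)
    fix s :: complex assume s: "s \<noteq> 0 \<and> norm s < 2 * pi"
    have "(\<lambda>n. complex_of_real (bernpoly n x) / fact n * (-s) ^ n) sums
           (-s * exp (-s * complex_of_real x) / (exp (-s) - 1))"
      by (rule bernpoly_sums) (use s in auto)
    moreover have "complex_of_real (bernpoly n x) / fact n * (-s) ^ n =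
        complex_of_real ((-1) ^ n * bernpoly n x) / fact n * s ^ n" for n
      by (subst power_minus) simp
    moreover have "-s * exp (-s * complex_of_real x) / (exp (-s) - 1) =
        s * exp (s * complex_of_real (1 - x)) / (exp s - 1)"
      \<comment> \<open>If \<open>exp s = 1\<close>, both denominators are \<open>0\<close> and so are both quotients.\<close>
    proof (cases "exp s = 1")
      case False
      have frac: "- s * e / (1 / E - 1) = s * (E * e) / (E - 1)" if "E \<noteq> 0" "E \<noteq> 1" for e E
        using that by (simp add: divide_simps) (simp add: algebra_simps)
      have "exp (s * complex_of_real (1 - x)) = exp s * exp (-s * complex_of_real x)"
        by (simp add: exp_add [symmetric] algebra_simps)
      moreover have "exp (-s) = 1 / exp s"
        by (simp add: exp_minus field_simps)
      ultimately show ?thesis using False by (simp only: frac exp_not_eq_zero not_False_eq_True)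
    qed (simp add: exp_minus)
    ultimately show "(\<lambda>n. complex_of_real ((-1) ^ n * bernpoly n x) / fact n * s ^ n) sums
        (s * exp (s * complex_of_real (1 - x)) / (exp s - 1))" by (simp only:)
  qed
  from bernpoly_eqI[OF this] show ?thesis .
qed

lemma bernpoly_odd_half: "odd n \<Longrightarrow> bernpoly n (1/2) = 0"
  using bernpoly_reflect[of n "1/2"] by simp

text \<open>The generating functions at \<open>x = 1\<close> and \<open>x = 0\<close> differ by \<open>s\<close>.\<close>
lemma bernpoly_at_1: "bernpoly n 1 = bernpoly n 0 + (if n = 1 then 1 else 0)"
proof -
  have "bernpoly_gf 1 (\<lambda>n. bernpoly n 0 + (if n = 1 then 1 else 0))"
    unfolding bernpoly_gf_def
  proof (intro allI impI)
    fix s :: complex assume s: "s \<noteq> 0 \<and> norm s < 2 * pi"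
    have "exp s \<noteq> 1"
    proof
      assume "exp s = 1"
      then obtain n :: int where n: "Re s = 0" "Im s = of_int (2 * n) * pi"
        unfolding exp_eq_1 by blast
      with s have "n \<noteq> 0" by (auto simp: complex_eq_iff)
      hence "2 * pi \<le> \<bar>of_int (2 * n)\<bar> * pi" by (intro mult_right_mono) auto
      also have "\<dots> = \<bar>Im s\<bar>" using n by (simp add: abs_mult)
      also have "\<dots> \<le> norm s" by (rule abs_Im_le_cmod)
      finally show False using s by simp
    qed
    have "(\<lambda>n. complex_of_real (bernpoly n 0) / fact n * s ^ n +
              (if n = 1 then s ^ n else 0)) sums
           (s * exp (s * complex_of_real 0) / (exp s - 1) + s ^ 1)"
      by (intro sums_add bernpoly_sums sums_single) (use s in auto)
    moreover have "complex_of_real (bernpoly n 0) / fact n * s ^ n + (if n = 1 then s ^ n else 0) =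
        complex_of_real (bernpoly n 0 + (if n = 1 then 1 else 0)) / fact n * s ^ n" for n
      by (simp add: algebra_simps)
    moreover have "s * exp (s * complex_of_real 0) / (exp s - 1) + s ^ 1 =
        s * exp (s * complex_of_real 1) / (exp s - 1)"
      using \<open>exp s \<noteq> 1\<close> by (simp add: field_simps)
    ultimately show "(\<lambda>n. complex_of_real (bernpoly n 0 + (if n = 1 then 1 else 0)) / fact n * s ^ n)
        sums (s * exp (s * complex_of_real 1) / (exp s - 1))" by simp
  qed
  from bernpoly_eqI[OF this] show ?thesis .
qed

lemma bernpoly_odd_0: "odd n \<Longrightarrow> bernpoly n 0 = (if n = 1 then -1/2 else 0)"
  using bernpoly_reflect[of n 0] bernpoly_at_1[of n] by (auto split: if_splits)

lemma bernpoly_0: "bernpoly 0 x = 1"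
  by (simp add: bernpoly_conv_fps)

text \<open>A polynomial with derivative \<open>B\<^sub>0 = 1\<close> that vanishes at \<open>1/2\<close>.\<close>
lemma bernpoly_1: "bernpoly 1 x = x - 1/2"
proof -
  have "((\<lambda>x. bernpoly 1 x - x) has_real_derivative 0) (at y)" for y
    using bernpoly_div_fact_has_derivative[of 0 y]
    by (auto intro!: derivative_eq_intros simp: bernpoly_0 bernpoly_div_fact_def [abs_def])
  hence "bernpoly 1 x - x = bernpoly 1 (1/2) - 1/2"
    by (intro DERIV_isconst_all) auto
  thus ?thesis by (simp add: bernpoly_odd_half)
qed

section \<open>Iterated derivatives of the logarithm and of the log-gamma function\<close>

definition ln_deriv :: "nat \<Rightarrow> real \<Rightarrow> real" where
  "ln_deriv n t = (if n = 0 then ln t else (-1) ^ (n - 1) * fact (n - 1) / t ^ n)"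

definition ln_Gamma_deriv :: "nat \<Rightarrow> real \<Rightarrow> real" where
  "ln_Gamma_deriv n t = (if n = 0 then ln_Gamma t else Polygamma (n - 1) t)"

lemma has_derivative_ln_deriv:
  assumes "t > 0"
  shows "(ln_deriv n has_real_derivative ln_deriv (Suc n) t) (at t)"
proof (cases n)
  case 0
  have "(ln has_real_derivative 1 / t) (at t)"
    using assms by (auto intro!: derivative_eq_intros)
  moreover have "ln_deriv 0 = ln"
    by (simp add: ln_deriv_def fun_eq_iff)
  ultimately show ?thesis using 0 by (simp add: ln_deriv_def)
next
  case (Suc k)
  have "((\<lambda>t. (-1) ^ k * fact k / t ^ Suc k) has_real_derivative
          (-1) ^ Suc k * fact (Suc k) / t ^ Suc (Suc k)) (at t)"
    by (rule DERIV_cong[OF DERIV_divide[OF DERIV_const DERIV_pow]])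
      (use assms in \<open>simp_all add: field_simps del: of_nat_Suc\<close>)
  thus ?thesis using Suc by (simp add: ln_deriv_def [abs_def])
qed

lemma has_derivative_ln_Gamma_deriv:
  assumes "t > 0"
  shows "(ln_Gamma_deriv n has_real_derivative ln_Gamma_deriv (Suc n) t) (at t)"
proof -
  have "t \<notin> \<int>\<^sub>\<le>\<^sub>0" using assms by (auto elim!: nonpos_Ints_cases)
  thus ?thesis
    using assms has_field_derivative_ln_Gamma_real[of t]
      has_field_derivative_Polygamma[of t "n - 1" UNIV]
    by (cases n) (simp_all add: ln_Gamma_deriv_def [abs_def])
qed

lemmas chain_ln_deriv [derivative_intros] = has_derivative_ln_deriv [THEN DERIV_chain2]
lemmas chain_ln_Gamma_deriv [derivative_intros] = has_derivative_ln_Gamma_deriv [THEN DERIV_chain2]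

lemma Gamma_real_neq_0: "x > 0 \<Longrightarrow> Gamma x \<noteq> (0 :: real)"
  by (metis Gamma_real_pos less_irrefl)

lemma ln_Gamma_deriv_plus1:
  assumes "t > 0"
  shows "ln_Gamma_deriv n (t + 1) = ln_Gamma_deriv n t + ln_deriv n t"
proof (cases n)
  case 0
  have "Gamma (t + 1) = t * Gamma t"
    using assms by (intro Gamma_plus1) (auto elim!: nonpos_Ints_cases)
  thus ?thesis using 0 assms
    by (simp add: ln_Gamma_deriv_def ln_deriv_def ln_Gamma_real_pos ln_mult Gamma_real_neq_0)
next
  case (Suc k)
  thus ?thesis using assms Polygamma_plus1[of t k]
    by (simp add: ln_Gamma_deriv_def ln_deriv_def)
qed

lemma ln_Gamma_deriv_mono:
  assumes "n > 0" "0 < a" "a \<le> b"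
  shows "(-1) ^ n * ln_Gamma_deriv n b \<le> (-1) ^ n * ln_Gamma_deriv n a"
proof (cases "a = b")
  case False
  hence "a < b" using assms by simp
  thus ?thesis
    using assms Polygamma_real_strict_mono[of a b "n - 1"]
      Polygamma_real_strict_antimono[of a b "n - 1"]
    by (cases "even n") (auto simp: ln_Gamma_deriv_def)
qed simp

section \<open>Remainders of the expansions and their signs\<close>

text \<open>
  The \<open>n\<close>th \<open>t\<close>-derivative of \<open>h\<^sub>k\<close>. The number \<open>k\<close> of terms starts at \<open>0\<close>, where only the
  log-gamma part is left, so that the recursion in \<open>x\<close> also yields the case \<open>k = 1\<close>, which is \<open>H 0\<close>.
\<close>
definition h_rem :: "nat \<Rightarrow> nat \<Rightarrow> real \<Rightarrow> real \<Rightarrow> real" where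
  "h_rem k n x t = ln_Gamma_deriv n (t + 1 - x) - ln_Gamma_deriv n (t + x)
     + 2 * (\<Sum>l<k. bernpoly_div_fact (2 * l + 1) x * ln_deriv (2 * l + n) t)"

text \<open>The \<open>n\<close>th \<open>t\<close>-derivative of \<open>g\<^sub>m\<close>; the index \<open>l\<close> is shifted by one against the sum in \<open>G\<close>.\<close>
definition g_rem :: "nat \<Rightarrow> nat \<Rightarrow> real \<Rightarrow> real \<Rightarrow> real" where
  "g_rem m n x t = ln_Gamma_deriv n (t + 1 - x) + ln_Gamma_deriv n (t + x)
     - ln_Gamma_deriv n t - ln_Gamma_deriv n (t + 1)
     - 2 * (\<Sum>l<m. (bernpoly_div_fact (2 * l + 2) x - bernpoly_div_fact (2 * l + 2) 0)
                    * ln_deriv (2 * l + 1 + n) t)"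

definition h_rem_x_deriv :: "nat \<Rightarrow> nat \<Rightarrow> real \<Rightarrow> real \<Rightarrow> real" where
  "h_rem_x_deriv k n x t = - ln_Gamma_deriv (Suc n) (t + 1 - x) - ln_Gamma_deriv (Suc n) (t + x)
     + 2 * (\<Sum>l<k. bernpoly_div_fact (2 * l) x * ln_deriv (2 * l + n) t)"

lemma h_rem_has_t_derivative:
  assumes "x \<in> {0..1/2}" "t > 0"
  shows "(h_rem k n x has_real_derivative h_rem k (Suc n) x t) (at t)"
  unfolding h_rem_def using assms
  by (auto intro!: derivative_eq_intros simp: mult.commute)

lemma g_rem_has_t_derivative:
  assumes "x \<in> {0..1/2}" "t > 0"
  shows "(g_rem m n x has_real_derivative g_rem m (Suc n) x t) (at t)"
  unfolding g_rem_def using assms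
  by (auto intro!: derivative_eq_intros simp: mult.commute)

lemma g_rem_has_x_derivative:
  assumes "x \<in> {0..1/2}" "t > 0"
  shows "((\<lambda>x. g_rem m n x t) has_real_derivative - h_rem m (Suc n) x t) (at x)"
proof -
  have [derivative_intros]: "(bernpoly_div_fact (2 * l + 2) has_real_derivative
      bernpoly_div_fact (2 * l + 1) x) (at x)" for l
    using bernpoly_div_fact_has_derivative[of "2 * l + 1" x] by simp
  show ?thesis
    unfolding g_rem_def h_rem_def using assms
    by (auto intro!: derivative_eq_intros simp del: add_2_eq_Suc')
qed

lemma h_rem_has_x_derivative:
  assumes "x \<in> {0..1/2}" "t > 0"
  shows "((\<lambda>x. h_rem k n x t) has_real_derivative h_rem_x_deriv k n x t) (at x)"
proof -
  have [derivative_intros]: "(bernpoly_div_fact (2 * l + 1) has_real_derivative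
      bernpoly_div_fact (2 * l) x) (at x)" for l
    using bernpoly_div_fact_has_derivative[of "2 * l" x] by simp
  show ?thesis
    unfolding h_rem_def h_rem_x_deriv_def using assms
    by (auto intro!: derivative_eq_intros simp del: Suc_eq_plus1 add_Suc_right One_nat_def)
qed

text \<open>
  The second differentiation removes the term \<open>l = 0\<close>, whose coefficient is the constant \<open>B\<^sub>0\<close>;
  what remains is the second \<open>t\<close>-derivative of the remainder with one term less.
\<close>
lemma h_rem_x_deriv_has_x_derivative:
  assumes "x \<in> {0..1/2}" "t > 0"
  shows "((\<lambda>x. h_rem_x_deriv (Suc k) n x t) has_real_derivative h_rem k (n + 2) x t) (at x)"
proof -
  have [derivative_intros]: "(bernpoly_div_fact (2 * Suc l) has_real_derivative
      bernpoly_div_fact (2 * l + 1) x) (at x)" for l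
    using bernpoly_div_fact_has_derivative[of "2 * l + 1" x] by simp
  have [simp]: "ln_deriv (2 * Suc l + n) t = ln_deriv (Suc (Suc (2 * l + n))) t" for l
    by simp
  have [simp]: "bernpoly_div_fact 0 = (\<lambda>_. 1)"
    by (simp add: fun_eq_iff bernpoly_div_fact_def bernpoly_0)
  show ?thesis
    unfolding h_rem_def h_rem_x_deriv_def sum.lessThan_Suc_shift using assms
    by (auto intro!: derivative_eq_intros simp del: mult_Suc_right)
qed

lemma h_rem_at_0:
  assumes "t > 0"
  shows "h_rem (Suc k) n 0 t = 0"
  using assms ln_Gamma_deriv_plus1[of t n]
  by (simp add: h_rem_def sum.lessThan_Suc_shift bernpoly_div_fact_def bernpoly_odd_0 del: sum.lessThan_Suc)

lemma h_rem_at_half: "h_rem k n (1/2) t = 0"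
  by (simp add: h_rem_def bernpoly_div_fact_def bernpoly_odd_half algebra_simps)

lemma g_rem_at_0: "g_rem m n 0 t = 0"
  by (simp add: g_rem_def)

lemma nonneg_if_concave_zero_boundary:
  fixes f :: "real \<Rightarrow> real"
  assumes "\<And>x. x \<in> {a..b} \<Longrightarrow> (f has_real_derivative f' x) (at x)"
    and "\<And>x. x \<in> {a..b} \<Longrightarrow> (f' has_real_derivative f'' x) (at x)"
    and "\<And>x. x \<in> {a..b} \<Longrightarrow> f'' x \<le> 0"
    and "f a = 0" "f b = 0" "c \<in> {a..b}"
  shows "f c \<ge> 0"
proof -
  have "convex_on {a..b} (\<lambda>x. - f x)"
  proof (rule f''_ge0_imp_convex)
    show "((\<lambda>x. - f x) has_real_derivative - f' x) (at x)" if "x \<in> {a..b}" for x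
      using assms(1)[OF that] by (rule DERIV_minus)
    show "((\<lambda>x. - f' x) has_real_derivative - f'' x) (at x)" if "x \<in> {a..b}" for x
      using assms(2)[OF that] by (rule DERIV_minus)
  qed (use assms(3) in auto)
  from convex_onD_Icc'[OF this assms(6)] show ?thesis
    using assms(4,5) by simp
qed

text \<open>
  The induction on \<open>k\<close> trades one unit of \<open>k\<close> for two \<open>t\<close>-derivatives by concavity in \<open>x\<close>,
  and ends at monotonicity of a derivative of the log-gamma function. That function itself is
  not monotone on \<open>(0,\<infinity>)\<close>, so \<open>0 < k + n\<close> excludes the undifferentiated \<open>h\<^sub>0\<close>.
\<close>
lemma h_rem_sign:
  assumes "0 < k + n" "x \<in> {0..1/2}" "t > 0"
  shows "0 \<le> (-1) ^ (k + n + 1) * h_rem k n x t"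
  using assms
proof (induction k arbitrary: n x)
  case 0
  have "(-1) ^ n * ln_Gamma_deriv n (t + 1 - x) \<le> (-1) ^ n * ln_Gamma_deriv n (t + x)"
    by (rule ln_Gamma_deriv_mono) (use 0 in auto)
  thus ?case by (simp add: h_rem_def algebra_simps)
next
  case (Suc k)
  define s :: real where "s = (-1) ^ (Suc k + n + 1)"
  show ?case
    unfolding s_def [symmetric]
  proof (rule nonneg_if_concave_zero_boundary [where f = "\<lambda>x. s * h_rem (Suc k) n x t"])
    fix y :: real assume y: "y \<in> {0..1/2}"
    show "((\<lambda>x. s * h_rem (Suc k) n x t) has_real_derivative s * h_rem_x_deriv (Suc k) n y t) (at y)"
      by (rule DERIV_cmult[OF h_rem_has_x_derivative]) (use y Suc.prems in auto)
    show "((\<lambda>x. s * h_rem_x_deriv (Suc k) n x t) has_real_derivative s * h_rem k (n + 2) y t) (at y)"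
      by (rule DERIV_cmult[OF h_rem_x_deriv_has_x_derivative]) (use y Suc.prems in auto)
    have "0 \<le> (-1) ^ (k + (n + 2) + 1) * h_rem k (n + 2) y t"
      by (rule Suc.IH) (use y Suc.prems in auto)
    thus "s * h_rem k (n + 2) y t \<le> 0"
      by (simp add: s_def)
  qed (use Suc.prems in \<open>simp_all add: h_rem_at_0 h_rem_at_half\<close>)
qed

lemma g_rem_sign:
  assumes "x \<in> {0..1/2}" "t > 0"
  shows "0 \<le> (-1) ^ (m + n + 1) * g_rem m n x t"
proof -
  define s :: real where "s = (-1) ^ (m + n + 1)"
  have "s * g_rem m n 0 t \<le> s * g_rem m n x t"
  proof (rule DERIV_nonneg_imp_nondecreasing [where f = "\<lambda>x. s * g_rem m n x t"])
    fix y assume y: "0 \<le> y" "y \<le> x"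
    hence y': "y \<in> {0..1/2}" using assms by auto
    have "0 \<le> (-1) ^ (m + Suc n + 1) * h_rem m (Suc n) y t"
      by (rule h_rem_sign) (use y' assms in auto)
    hence "0 \<le> s * - h_rem m (Suc n) y t"
      by (simp add: s_def)
    moreover have "((\<lambda>x. s * g_rem m n x t) has_real_derivative s * - h_rem m (Suc n) y t) (at y)"
      by (rule DERIV_cmult[OF g_rem_has_x_derivative[OF y' assms(2)]])
    ultimately show "\<exists>d. ((\<lambda>x. s * g_rem m n x t) has_real_derivative d) (at y) \<and> 0 \<le> d"
      by blast
  qed (use assms in auto)
  thus ?thesis by (simp add: g_rem_at_0 s_def)
qed

section \<open>Complete monotonicity\<close>

lemma completely_monotonic_onI:
  fixes F :: "nat \<Rightarrow> real \<Rightarrow> real"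
  assumes "open I"
    and f: "\<And>t. t \<in> I \<Longrightarrow> f t = F 0 t"
    and F: "\<And>n t. t \<in> I \<Longrightarrow> (F n has_real_derivative F (Suc n) t) (at t)"
    and sign: "\<And>n t. t \<in> I \<Longrightarrow> 0 \<le> (-1) ^ n * F n t"
  shows "completely_monotonic_on I f"
proof -
  have eq: "(deriv ^^ n) f t = F n t" if "t \<in> I" for n t
    using that
  proof (induction n arbitrary: t)
    case (Suc n)
    have "eventually (\<lambda>u. (deriv ^^ n) f u = F n u) (nhds t)"
      using eventually_nhds_in_open[OF assms(1) Suc.prems]
      by (rule eventually_mono) (rule Suc.IH)
    hence "deriv ((deriv ^^ n) f) t = deriv (F n) t"
      by (rule deriv_cong_ev) simp
    also have "\<dots> = F (Suc n) t"
      using F[OF Suc.prems] by (rule DERIV_imp_deriv)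
    finally show ?case by simp
  qed (simp add: f)
  have "(deriv ^^ n) f differentiable at t" if "t \<in> I" for n t
  proof -
    have "((deriv ^^ n) f has_real_derivative F (Suc n) t) (at t)"
      using F[OF that] assms(1) that
      by (rule has_field_derivative_transform_within_open) (simp add: eq)
    thus ?thesis by (auto simp: real_differentiable_def)
  qed
  thus ?thesis
    unfolding completely_monotonic_on_def using eq sign by auto
qed

text \<open>
  With \<open>t\<^bsup>-2l\<^esup> = -(log t)\<^bsup>(2l)\<^esup>/(2l-1)!\<close> the coefficients \<open>1/(l(2l+1))\<close> become \<open>-2/(2l+1)!\<close>.
\<close>
lemma H_conv_h_rem:
  assumes "x \<in> {0..1/2}" "t > 0"
  shows "H m x t = (-1) ^ m * h_rem (Suc m) 0 x t"
proof -
  have term_eq: "bernpoly (2 * Suc l + 1) x / (real (Suc l) * (2 * real (Suc l) + 1))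
        * (1 / t ^ (2 * Suc l)) =
      - 2 * (bernpoly_div_fact (2 * Suc l + 1) x * ln_deriv (2 * Suc l + 0) t)" for l
  proof -
    define q where "q = real (Suc l) * (2 * real (Suc l) + 1)"
    have "fact (2 * Suc l + 1) = 2 * q * fact (2 * l + 1)"
      by (simp add: q_def algebra_simps)
    moreover have "ln_deriv (2 * Suc l + 0) t = - fact (2 * l + 1) / t ^ (2 * Suc l)"
      by (simp add: ln_deriv_def)
    ultimately show ?thesis
      unfolding q_def [symmetric] by (simp add: bernpoly_div_fact_def del: fact_Suc power_Suc mult_Suc_right)
  qed
  have "(\<Sum>l=1..m. bernpoly (2 * l + 1) x / (real l * (2 * real l + 1)) * (1 / t ^ (2 * l))) =
      (\<Sum>l<m. - 2 * (bernpoly_div_fact (2 * Suc l + 1) x * ln_deriv (2 * Suc l + 0) t))"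
    unfolding term_eq [symmetric]
    by (rule sum.reindex_bij_witness[of _ Suc "\<lambda>l. l - 1"]) auto
  hence "(\<Sum>l=1..m. bernpoly (2 * l + 1) x / (real l * (2 * real l + 1)) * (1 / t ^ (2 * l))) =
      - 2 * (\<Sum>l<m. bernpoly_div_fact (2 * Suc l + 1) x * ln_deriv (2 * Suc l + 0) t)"
    unfolding sum_distrib_left .
  moreover have "ln (Gamma (t + 1 - x) / (t powr (1 - 2 * x) * Gamma (t + x))) =
      ln_Gamma (t + 1 - x) - ln_Gamma (t + x) - (1 - 2 * x) * ln t"
    using assms by (simp add: ln_div ln_mult ln_powr ln_Gamma_real_pos Gamma_real_neq_0)
  ultimately show ?thesis
    unfolding H_def h_rem_def sum.lessThan_Suc_shift
    by (simp only: ln_Gamma_deriv_def)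
      (simp add: bernpoly_div_fact_def ln_deriv_def bernpoly_1 [simplified] algebra_simps
        del: fact_Suc mult_Suc_right power_Suc)
qed

text \<open>
  With \<open>t\<^bsup>-(2l-1)\<^esup> = (log t)\<^bsup>(2l-1)\<^esup>/(2l-2)!\<close> the coefficients \<open>1/(l(2l-1))\<close> become \<open>2/(2l)!\<close>.
\<close>
lemma G_conv_g_rem:
  assumes "x \<in> {0..1/2}" "t > 0"
  shows "G m x t = - ((-1) ^ m * g_rem m 0 x t)"
proof -
  have sign: "(-1) powi (int m - 1) = - ((-1 :: real) ^ m)"
    by (simp add: power_int_diff)
  have term_eq: "(bernpoly (2 * Suc l) x - bernoulli (2 * Suc l)) /
        (real (Suc l) * (2 * real (Suc l) - 1)) * (1 / t ^ (2 * Suc l - 1)) =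
      2 * ((bernpoly_div_fact (2 * l + 2) x - bernpoly_div_fact (2 * l + 2) 0)
        * ln_deriv (2 * l + 1 + 0) t)" for l
  proof -
    define q where "q = real (Suc l) * (2 * real (Suc l) - 1)"
    have frac: "(a - b) / q * (1 / T) = 2 * ((a / (2 * q * F) - b / (2 * q * F)) * (F / T))"
      if "F \<noteq> 0" for a b T F :: real
      using that by (cases "q = 0"; cases "T = 0") (simp_all add: field_simps)
    have "fact (2 * l + 2) = 2 * q * fact (2 * l)"
      by (simp add: q_def algebra_simps)
    moreover have "2 * Suc l = 2 * l + 2" "2 * l + 2 - 1 = 2 * l + 1 + (0::nat)" by auto
    moreover have "ln_deriv (2 * l + 1 + 0) t = fact (2 * l) / t ^ (2 * l + 1 + 0)"
      by (simp add: ln_deriv_def)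
    ultimately show ?thesis
      unfolding q_def [symmetric]
      by (simp only: bernpoly_div_fact_def bernoulli_def) (rule frac, simp)
  qed
  have sums: "(\<Sum>l=1..m. (bernpoly (2 * l) x - bernoulli (2 * l)) / (real l * (2 * real l - 1))
                     * (1 / t ^ (2 * l - 1))) =
      2 * (\<Sum>l<m. (bernpoly_div_fact (2 * l + 2) x - bernpoly_div_fact (2 * l + 2) 0)
        * ln_deriv (2 * l + 1 + 0) t)"
    unfolding sum_distrib_left term_eq [symmetric]
    by (rule sum.reindex_bij_witness[of _ Suc "\<lambda>l. l - 1"]) auto
  have ln_ratio: "ln (Gamma (t + 1 - x) * Gamma (t + x) / (Gamma t * Gamma (t + 1))) =
      ln_Gamma (t + 1 - x) + ln_Gamma (t + x) - ln_Gamma t - ln_Gamma (t + 1)"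
    using assms by (simp add: ln_div ln_mult ln_Gamma_real_pos Gamma_real_neq_0)
  show ?thesis
    unfolding G_def g_rem_def sign sums ln_ratio by (simp add: ln_Gamma_deriv_def algebra_simps)
qed

theorem theorem3p2:
  fixes m :: nat and x :: real
  assumes "x \<in> {0..1/2}"
  shows "completely_monotonic_on {0<..} (\<lambda>t. G m x t) \<and>
         completely_monotonic_on {0<..} (\<lambda>t. H m x t)"
proof
  show "completely_monotonic_on {0<..} (\<lambda>t. G m x t)"
  proof (rule completely_monotonic_onI [where F = "\<lambda>n t. - ((-1) ^ m) * g_rem m n x t"])
    fix n :: nat and t :: real assume t: "t \<in> {0<..}"
    show "G m x t = - ((-1) ^ m) * g_rem m 0 x t"
      using G_conv_g_rem[OF assms] t by simp
    show "((\<lambda>t. - ((-1) ^ m) * g_rem m n x t) has_real_derivative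
        - ((-1) ^ m) * g_rem m (Suc n) x t) (at t)"
      by (rule DERIV_cmult[OF g_rem_has_t_derivative[OF assms]]) (use t in simp)
    show "0 \<le> (-1) ^ n * (- ((-1) ^ m) * g_rem m n x t)"
      using g_rem_sign[OF assms, of t m n] t by (simp add: power_add mult_ac)
  qed simp
  show "completely_monotonic_on {0<..} (\<lambda>t. H m x t)"
  proof (rule completely_monotonic_onI [where F = "\<lambda>n t. (-1) ^ m * h_rem (Suc m) n x t"])
    fix n :: nat and t :: real assume t: "t \<in> {0<..}"
    show "H m x t = (-1) ^ m * h_rem (Suc m) 0 x t"
      using H_conv_h_rem[OF assms] t by simp
    show "((\<lambda>t. (-1) ^ m * h_rem (Suc m) n x t) has_real_derivative
        (-1) ^ m * h_rem (Suc m) (Suc n) x t) (at t)"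
      by (rule DERIV_cmult[OF h_rem_has_t_derivative[OF assms]]) (use t in simp)
    show "0 \<le> (-1) ^ n * ((-1) ^ m * h_rem (Suc m) n x t)"
      using h_rem_sign[OF _ assms, of "Suc m" n t] t by (simp add: power_add mult_ac)
  qed simp
qed

end
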